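(* Let $K_1,\dots,K_r\subset\mathbb{R}^n$ be closed convex sets, and consider the problem of finding a point $x\in K$, where $K=\bigcap_{l=1}^rK_l$. Suppose the mass projection algorithm with parameter $\bar p$ (described in the context) produces a sequence $\{x_i\}$ that converges to a point $\bar x\in K$. Suppose also that: (1) If $\sum_{l=1}^rv_l=0$ for some $v_l\in N_{K_l}(\bar x)$, then $v_l=0$ for all $l=1,\dots,r$. If $\bar p$ in the mass projection algorithm is sufficiently large, then $$\limsup_{i\to\infty}\frac{\|x_{i+\bar p}-\bar x\|}{\|x_i-\bar x\|}=0.$$ Moreover, for that choice of $\bar p$, if for some $\bar\epsilon>0$ $$[K_l-\bar x]\cap\bar\epsilon\mathbb{B}=T_{K_l}(\bar x)\cap\bar\epsilon\mathbb{B}\quad\text{for all } l=1,\dots,r,$$ then the convergence of $\{x_i\}$ to $\bar x$ is finite (that is, $\bar x$ is reached after finitely many iterations).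
   Context: $P_C$ denotes the metric projection onto a closed convex set $C$; $\mathbb{B}$ is the closed unit ball of $\mathbb{R}^n$; $T_C(\bar x)$ and $N_C(\bar x)$ are the tangent cone and normal cone of the convex set $C$ at $\bar x\in C$. Mass projection algorithm with parameter $\bar p$ (some positive integer): given a starting iterate $x_0\in\mathbb{R}^n$, for $i=1,2,\dots$ and each $j\in\{1,\dots,r\}$ set $$x_i^{(j)}=P_{K_j}(x_{i-1}),\quad a_i^{(j)}=x_{i-1}-x_i^{(j)},\quad b_i^{(j)}=\langle a_i^{(j)},x_i^{(j)}\rangle\in\mathbb{R};$$ define $$\tilde F_i:=\{x\in\mathbb{R}^n\mid\langle a_l^{(j)},x\rangle\leq b_l^{(j)}\text{ for } 1\leq j\leq r,\ \max(1,i-\bar p)\leq l\leq i\},$$ and set $x_i=P_{\tilde F_i}(x_{i-1})$. *)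

theory Defs
  imports "HOL-Analysis.Analysis"
begin

definition normal_cone :: "(real ^ 'n) set \<Rightarrow> real ^ 'n \<Rightarrow> (real ^ 'n) set" where
  "normal_cone C xb = {v. \<forall>y\<in>C. inner v (y - xb) \<le> 0}"

(* Bouligand (contingent) cone; for convex C it is the closure of the cone
   generated by C - xb. *)
definition tangent_cone :: "(real ^ 'n) set \<Rightarrow> real ^ 'n \<Rightarrow> (real ^ 'n) set" where
  "tangent_cone C xb =
     {w. \<exists>(t :: nat \<Rightarrow> real) (v :: nat \<Rightarrow> real ^ 'n).
           (\<forall>k. 0 < t k) \<and> t \<longlonglongrightarrow> 0 \<and> v \<longlonglongrightarrow> w \<and> (\<forall>k. xb + t k *\<^sub>R v k \<in> C)}"

(* The data produced at step i \<ge> 1 from the sequence of iterates x, for the set K j. *)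

definition mp_point ::
  "(nat \<Rightarrow> (real ^ 'n) set) \<Rightarrow> (nat \<Rightarrow> real ^ 'n) \<Rightarrow> nat \<Rightarrow> nat \<Rightarrow> real ^ 'n" where
  "mp_point K x i j = closest_point (K j) (x (i - 1))"

definition mp_a ::
  "(nat \<Rightarrow> (real ^ 'n) set) \<Rightarrow> (nat \<Rightarrow> real ^ 'n) \<Rightarrow> nat \<Rightarrow> nat \<Rightarrow> real ^ 'n" where
  "mp_a K x i j = x (i - 1) - mp_point K x i j"

definition mp_b ::
  "(nat \<Rightarrow> (real ^ 'n) set) \<Rightarrow> (nat \<Rightarrow> real ^ 'n) \<Rightarrow> nat \<Rightarrow> nat \<Rightarrow> real" where
  "mp_b K x i j = inner (mp_a K x i j) (mp_point K x i j)"

(* The subtraction i - p is truncated at 0, which does not affect max 1 (i - p). *)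
definition mp_F ::
  "nat \<Rightarrow> (nat \<Rightarrow> (real ^ 'n) set) \<Rightarrow> nat \<Rightarrow> (nat \<Rightarrow> real ^ 'n) \<Rightarrow> nat \<Rightarrow> (real ^ 'n) set" where
  "mp_F r K p x i =
     {y. \<forall>j\<in>{1..r}. \<forall>l\<in>{max 1 (i - p)..i}. inner (mp_a K x l j) y \<le> mp_b K x l j}"

(* x is the sequence of iterates of the algorithm with parameter p and sets K 1, ..., K r,
   started at the arbitrary point x 0. *)
definition mass_projection_iterates ::
  "nat \<Rightarrow> (nat \<Rightarrow> (real ^ 'n) set) \<Rightarrow> nat \<Rightarrow> (nat \<Rightarrow> real ^ 'n) \<Rightarrow> bool" where
  "mass_projection_iterates r K p x \<longleftrightarrow>
     (\<forall>i\<ge>1. x i = closest_point (mp_F r K p x i) (x (i - 1)))"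

end

theory Submission
  imports Defs
begin

text \<open>
  Write \<open>e\<^sub>k = x\<^sub>k - xbar\<close>, and let \<open>P\<^sub>j\<close> be the projection onto \<open>K\<^sub>j\<close>. Three facts about the
  cutting half-spaces \<open>{y. inner a y \<le> inner a (P\<^sub>j x\<^sub>k)}\<close> with \<open>a = x\<^sub>k - P\<^sub>j x\<^sub>k\<close> drive the proof.

  First, for late \<open>k\<close> some cut made at \<open>x\<^sub>k\<close> is deep: \<open>norm a \<ge> c * norm e\<^sub>k\<close> for a constant \<open>c\<close> that depends only on
  the sets and on \<open>xbar\<close>. The hypothesis on the normal cones yields a local error bound for the
  intersection (\<open>local_error_bound\<close>), so \<open>x\<^sub>k\<close> is far from one of the sets relative to its distance
  from the intersection; by Fejer monotonicity the latter is at least half of \<open>norm e\<^sub>k\<close>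
  (\<open>dist_limit_le_infdist\<close>). Second, the boundary of every late cut nearly passes through \<open>xbar\<close>:
  \<open>inner a (P\<^sub>j x\<^sub>k - xbar) \<le> \<eta> * norm a * norm e\<^sub>k\<close>, where \<open>\<eta> > 0\<close> is as small as desired
  (\<open>normal_offset_small\<close>) and \<open>\<eta> = 0\<close> is possible if the sets are conical near \<open>xbar\<close>
  (\<open>normal_offset_nonpos_if_conical\<close>). Third, the algorithm remembers its cuts, so that \<open>x\<^sub>m\<close>
  satisfies the cuts made at \<open>x\<^sub>k\<close> for \<open>k < m \<le> k + p\<close>.

  Suppose now that \<open>(c/2) * norm e\<^bsub>i+p\<^esub> > \<eta> * norm e\<^sub>i\<close>. The deep cut at \<open>x\<^sub>k\<close> has unit normal \<open>v\<close>
  with \<open>inner v (sgn e\<^sub>k) \<ge> c\<close>, whereas \<open>inner v (sgn e\<^sub>m) \<le> c/2\<close> for the later iterates in the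
  window. Hence the \<open>p + 1\<close> directions \<open>sgn e\<^sub>i, \<dots>, sgn e\<^bsub>i+p\<^esub>\<close> are pairwise \<open>c/2\<close>-separated, which
  is impossible once \<open>p\<close> reaches a packing number of the unit ball. That number depends on \<open>c\<close> and
  the dimension, but not on \<open>\<eta>\<close>. So one choice of \<open>p\<close> gives \<open>(c/2) * norm e\<^bsub>i+p\<^esub> \<le> \<eta> * norm e\<^sub>i\<close> for all late \<open>i\<close>
  (\<open>mass_projection_contraction\<close>): letting \<open>\<eta>\<close> tend to \<open>0\<close> gives superlinear convergence, and
  \<open>\<eta> = 0\<close> gives finite convergence.
\<close>

section \<open>Normals to sets near a reference point\<close>

lemma inner_sgn_right: "inner v (sgn u) = inner v u / norm u"
  for u v :: "'a::real_inner"
  by (simp add: sgn_div_norm divide_inverse_commute)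

lemma residual_in_normal_cone:
  assumes "convex C" "closed C"
  shows "y - closest_point C y \<in> normal_cone C (closest_point C y)"
  using closest_point_dot[OF assms] by (auto simp: normal_cone_def)

lemma dist_closest_point_le:
  fixes z :: "'a::euclidean_space"
  assumes "convex C" "closed C" "z \<in> C"
  shows "dist (closest_point C y) z \<le> dist y z"
proof -
  have "dist (closest_point C y) (closest_point C z) \<le> dist y z"
    using assms by (intro closest_point_lipschitz) auto
  then show ?thesis using assms by (simp add: closest_point_self)
qed

text \<open>
  A supporting half-space of \<open>C\<close> at a point \<open>y\<close> near \<open>xb\<close> misses \<open>xb\<close> only by
  \<open>o(norm (y - xb))\<close>. By compactness, finitely many points \<open>z\<close> of \<open>C\<close> represent all directions
  \<open>sgn (y - xb)\<close> up to \<open>\<epsilon>/2\<close>. As soon as \<open>y\<close> is much closer to \<open>xb\<close> than all of these \<open>z\<close>, a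
  normal at \<open>y\<close> must be almost nonpositive in each direction \<open>sgn (z - xb)\<close>, hence also in the
  direction of \<open>y\<close> itself.
\<close>
lemma normal_offset_small:
  fixes C :: "(real ^ 'n) set"
  assumes "0 < \<epsilon>"
  shows "\<exists>\<rho>>0. \<forall>y\<in>C. dist y xb < \<rho> \<longrightarrow>
           (\<forall>v\<in>normal_cone C y. inner v (y - xb) \<le> \<epsilon> * norm v * norm (y - xb))"
proof -
  let ?D = "(\<lambda>y. sgn (y - xb)) ` (C - {xb})"
  have "?D \<subseteq> cball 0 1" by (auto simp: norm_sgn split: if_splits)
  then have "compact (closure ?D)"
    by (meson bounded_cball bounded_subset compact_closure)
  moreover have "closure ?D \<subseteq> (\<Union>z\<in>C - {xb}. ball (sgn (z - xb)) (\<epsilon>/2))"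
  proof
    fix u assume "u \<in> closure ?D"
    then obtain d where "d \<in> ?D" "dist d u < \<epsilon>/2"
      using assms closure_approachable half_gt_zero by metis
    then show "u \<in> (\<Union>z\<in>C - {xb}. ball (sgn (z - xb)) (\<epsilon>/2))" by auto
  qed
  ultimately obtain Z where Z: "Z \<subseteq> C - {xb}" "finite Z"
      "closure ?D \<subseteq> (\<Union>z\<in>Z. ball (sgn (z - xb)) (\<epsilon>/2))"
    using compactE_image[of "closure ?D" "C - {xb}" "\<lambda>z. ball (sgn (z - xb)) (\<epsilon>/2)"]
    by auto
  define \<rho> where "\<rho> = Min (insert 1 ((\<lambda>z. norm (z - xb) * (\<epsilon>/2)) ` Z))"
  have "\<rho> > 0" using Z assms by (auto simp: \<rho>_def intro!: mult_pos_pos)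
  moreover have "inner v (y - xb) \<le> \<epsilon> * norm v * norm (y - xb)"
    if y: "y \<in> C" "dist y xb < \<rho>" and v: "v \<in> normal_cone C y" for y v
  proof (cases "y = xb")
    case False
    then have "sgn (y - xb) \<in> ?D" using y(1) by simp
    then have "sgn (y - xb) \<in> (\<Union>z\<in>Z. ball (sgn (z - xb)) (\<epsilon>/2))"
      using Z(3) closure_subset by (meson subsetD)
    then obtain z where z: "z \<in> Z" and near: "dist (sgn (z - xb)) (sgn (y - xb)) < \<epsilon>/2"
      by (auto simp only: UN_iff mem_ball)
    have zC: "z \<in> C" "z \<noteq> xb" using z Z by auto
    have "\<rho> \<le> norm (z - xb) * (\<epsilon>/2)"
      unfolding \<rho>_def using z Z(2) by (intro Min_le) auto
    then have close: "norm (y - xb) \<le> norm (z - xb) * (\<epsilon>/2)" using y by (simp add: dist_norm)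
    have "inner v (z - y) \<le> 0" using v zC by (simp add: normal_cone_def)
    then have "inner v (z - xb) \<le> inner v (y - xb)" by (simp add: inner_diff_right)
    also have "\<dots> \<le> norm v * norm (y - xb)" by (rule norm_cauchy_schwarz)
    also have "\<dots> \<le> norm v * (norm (z - xb) * (\<epsilon>/2))"
      using close by (intro mult_left_mono) auto
    finally have "inner v (sgn (z - xb)) \<le> norm v * (\<epsilon>/2)"
      using zC by (simp add: inner_sgn_right divide_le_eq mult.assoc mult.commute mult.left_commute)
    moreover have "inner v (sgn (y - xb) - sgn (z - xb)) \<le> norm v * (\<epsilon>/2)"
    proof -
      have "inner v (sgn (y - xb) - sgn (z - xb)) \<le> norm v * norm (sgn (y - xb) - sgn (z - xb))"
        by (rule norm_cauchy_schwarz)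
      also have "\<dots> \<le> norm v * (\<epsilon>/2)"
        using near by (intro mult_left_mono) (auto simp: dist_norm norm_minus_commute)
      finally show ?thesis .
    qed
    ultimately have "inner v (sgn (y - xb)) \<le> \<epsilon> * norm v"
      by (simp add: inner_diff_right mult.commute[of \<epsilon>])
    then show ?thesis using False by (simp add: inner_sgn_right divide_le_eq)
  qed simp
  ultimately show ?thesis by blast
qed

lemma tangent_cone_scaleR:
  assumes "w \<in> tangent_cone C xb" "0 < s"
  shows "s *\<^sub>R w \<in> tangent_cone C xb"
proof -
  obtain t v where tv: "\<forall>k. 0 < t k" "t \<longlonglongrightarrow> 0" "v \<longlonglongrightarrow> w"
      "\<forall>k::nat. xb + t k *\<^sub>R v k \<in> C"
    using assms by (auto simp: tangent_cone_def)
  have "(\<lambda>k. t k / s) \<longlonglongrightarrow> 0" using tendsto_divide_zero[OF tv(2)] by blast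
  moreover have "(\<lambda>k. s *\<^sub>R v k) \<longlonglongrightarrow> s *\<^sub>R w" using tv(3) by (intro tendsto_intros)
  moreover have "\<forall>k. 0 < t k / s" using tv(1) assms by simp
  moreover have "\<forall>k. xb + (t k / s) *\<^sub>R (s *\<^sub>R v k) \<in> C" using tv(4) assms by simp
  ultimately show ?thesis unfolding tangent_cone_def mem_Collect_eq
    by (intro exI[of _ "\<lambda>k. t k / s"] exI[of _ "\<lambda>k. s *\<^sub>R v k"] conjI)
qed

text \<open>
  If \<open>C\<close> is a cone with apex \<open>xb\<close> near \<open>xb\<close>, then \<open>C\<close> contains the point \<open>z = y + (y - xb)\<close>
  beyond \<open>y\<close>, and a normal at \<open>y\<close> cannot increase towards \<open>z\<close>.
\<close>
lemma normal_offset_nonpos_if_conical: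
  assumes con: "(\<lambda>y. y - xb) ` C \<inter> cball 0 \<epsilon> = tangent_cone C xb \<inter> cball 0 \<epsilon>"
    and y: "y \<in> C" "norm (y - xb) \<le> \<epsilon> / 2" and v: "v \<in> normal_cone C y"
  shows "inner v (y - xb) \<le> 0"
proof -
  have "norm (y - xb) \<le> \<epsilon>" using y(2) norm_ge_zero[of "y - xb"] by linarith
  then have "y - xb \<in> (\<lambda>y. y - xb) ` C \<inter> cball 0 \<epsilon>" using y(1) by simp
  then have "y - xb \<in> tangent_cone C xb" unfolding con by blast
  then have "2 *\<^sub>R (y - xb) \<in> tangent_cone C xb" by (rule tangent_cone_scaleR) simp
  moreover have "2 *\<^sub>R (y - xb) \<in> cball 0 \<epsilon>" using y by simp
  ultimately have "2 *\<^sub>R (y - xb) \<in> (\<lambda>y. y - xb) ` C \<inter> cball 0 \<epsilon>" unfolding con by blast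
  then obtain z where z: "z \<in> C" "2 *\<^sub>R (y - xb) = z - xb" by blast
  have "inner v (z - y) \<le> 0" using v z by (simp add: normal_cone_def)
  moreover have "z - y = y - xb" using z(2) by (simp add: algebra_simps scaleR_2)
  ultimately show ?thesis by simp
qed

section \<open>A local error bound for the intersection\<close>

lemma common_convergent_subsequence:
  fixes f :: "'i \<Rightarrow> nat \<Rightarrow> 'a::euclidean_space"
  assumes "finite I" "\<And>i. i \<in> I \<Longrightarrow> bounded (range (f i))"
  shows "\<exists>s::nat \<Rightarrow> nat. strict_mono s \<and> (\<forall>i\<in>I. convergent (f i \<circ> s))"
  using assms
proof (induction I)
  case empty
  show ?case using strict_mono_id by auto
next
  case (insert i I)
  then obtain s :: "nat \<Rightarrow> nat" where s: "strict_mono s" "\<forall>j\<in>I. convergent (f j \<circ> s)" by blast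
  have "bounded (range (f i \<circ> s))"
    using insert.prems[of i] by (auto intro: bounded_subset)
  then obtain l t where t: "strict_mono t" "((f i \<circ> s) \<circ> t) \<longlonglongrightarrow> l"
    using bounded_imp_convergent_subsequence by blast
  have "convergent (f j \<circ> (s \<circ> t))" if "j \<in> insert i I" for j
  proof (cases "j = i")
    case True
    then show ?thesis using t(2) by (auto simp: convergent_def o_assoc)
  next
    case False
    then have "convergent (f j \<circ> s)" using s that by auto
    then show ?thesis using t(1) by (metis convergent_subseq_convergent o_assoc)
  qed
  then show ?case using strict_mono_o[OF s(1) t(1)] by blast
qed

text \<open>
  The quantitative form of the hypothesis on normal cones. The sum \<open>\<Sum>i\<in>I. y - P\<^sub>i y\<close> is the gradient
  of half the sum of squared distances, and the lemma says that its norm controls the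
  root of that sum near \<open>xb\<close>. If this failed along a sequence tending to \<open>xb\<close>, the residuals,
  scaled so that their squares sum to \<open>1\<close>, would subconverge to normals at \<open>xb\<close> that sum to
  zero without all being zero.
\<close>
lemma residual_sum_lower_bound:
  fixes K :: "'i \<Rightarrow> (real ^ 'n) set"
  assumes fin: "finite I"
    and K: "\<And>i. i \<in> I \<Longrightarrow> closed (K i)" "\<And>i. i \<in> I \<Longrightarrow> convex (K i)" "\<And>i. i \<in> I \<Longrightarrow> xb \<in> K i"
    and reg: "\<And>v. \<lbrakk>\<forall>i\<in>I. v i \<in> normal_cone (K i) xb; (\<Sum>i\<in>I. v i) = 0\<rbrakk> \<Longrightarrow> \<forall>i\<in>I. v i = 0"
  shows "\<exists>c>0. \<forall>y. dist y xb < c \<longrightarrow>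
     c * L2_set (\<lambda>i. norm (y - closest_point (K i) y)) I \<le> norm (\<Sum>i\<in>I. y - closest_point (K i) y)"
proof (rule ccontr)
  let ?P = "\<lambda>i. closest_point (K i)"
  let ?f = "\<lambda>y. L2_set (\<lambda>i. norm (y - ?P i y)) I"
  assume neg: "\<not> ?thesis"
  have "\<exists>y. dist y xb < 1 / Suc n \<and> norm (\<Sum>i\<in>I. y - ?P i y) < 1 / Suc n * ?f y" for n :: nat
  proof -
    have "0 < 1 / real (Suc n)" by simp
    then show ?thesis using neg by (meson not_le)
  qed
  then obtain y where y: "\<And>n. dist (y n) xb < 1 / Suc n"
      "\<And>n. norm (\<Sum>i\<in>I. y n - ?P i (y n)) < 1 / Suc n * ?f (y n)"
    by metis
  have fpos: "?f (y n) > 0" for n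
  proof -
    have "0 < 1 / Suc n * ?f (y n)" using y(2)[of n] norm_ge_zero le_less_trans by blast
    then show ?thesis by (simp add: zero_less_divide_iff)
  qed
  define u where "u i n = (y n - ?P i (y n)) /\<^sub>R ?f (y n)" for i n
  have ule: "norm (u i n) \<le> 1" if "i \<in> I" for i n
    using member_le_L2_set[OF fin that, of "\<lambda>i. norm (y n - ?P i (y n))"] fpos[of n]
    by (simp add: u_def divide_simps)
  have "bounded (range (u i))" if "i \<in> I" for i
    using ule[OF that] by (auto simp: bounded_iff)
  then obtain s :: "nat \<Rightarrow> nat" where s: "strict_mono s" "\<forall>i\<in>I. convergent (u i \<circ> s)"
    using common_convergent_subsequence[OF fin] by blast
  then obtain v where v: "\<And>i. i \<in> I \<Longrightarrow> (u i \<circ> s) \<longlonglongrightarrow> v i"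
    unfolding convergent_def by metis
  have inv0: "(\<lambda>n. 1 / real (Suc (s n))) \<longlonglongrightarrow> 0"
    using LIMSEQ_subseq_LIMSEQ[OF LIMSEQ_inverse_real_of_nat s(1)]
    by (simp add: o_def inverse_eq_divide)
  (* The graph of the normal cone mapping is closed, and the projections tend to xb too. *)
  have "v i \<in> normal_cone (K i) xb" if i: "i \<in> I" for i
  proof -
    have "(\<lambda>n. ?P i (y (s n))) \<longlonglongrightarrow> xb"
    proof (rule metric_tendsto_imp_tendsto[OF inv0], rule always_eventually, rule allI)
      fix n
      have "dist (?P i (y (s n))) xb \<le> dist (y (s n)) xb"
        using dist_closest_point_le K i by blast
      then show "dist (?P i (y (s n))) xb \<le> dist (1 / real (Suc (s n))) 0"
        using y(1)[of "s n"] by (simp add: dist_norm)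
    qed
    then have "(\<lambda>n. inner (u i (s n)) (z - ?P i (y (s n)))) \<longlonglongrightarrow> inner (v i) (z - xb)" for z
      using v[OF i] by (intro tendsto_intros) (auto simp: o_def)
    moreover have "inner (u i n) (z - ?P i (y n)) \<le> 0" if "z \<in> K i" for z n
      using closest_point_dot[of "K i" z "y n"] K i that fpos[of n]
      by (simp add: u_def mult_le_0_iff)
    ultimately show ?thesis
      unfolding normal_cone_def mem_Collect_eq by (meson LIMSEQ_le_const2)
  qed
  moreover have "(\<Sum>i\<in>I. v i) = 0"
  proof -
    have "(\<lambda>n. \<Sum>i\<in>I. u i (s n)) \<longlonglongrightarrow> (\<Sum>i\<in>I. v i)"
      using v by (intro tendsto_sum) (auto simp: o_def)
    moreover have "(\<lambda>n. \<Sum>i\<in>I. u i (s n)) \<longlonglongrightarrow> 0"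
    proof (rule Lim_null_comparison[OF always_eventually inv0], rule allI)
      fix n
      have "(\<Sum>i\<in>I. u i (s n)) = (\<Sum>i\<in>I. y (s n) - ?P i (y (s n))) /\<^sub>R ?f (y (s n))"
        by (simp only: u_def scaleR_sum_right)
      then show "norm (\<Sum>i\<in>I. u i (s n)) \<le> 1 / real (Suc (s n))"
        using y(2)[of "s n"] fpos[of "s n"] by (simp add: divide_simps mult.commute)
    qed
    ultimately show ?thesis using LIMSEQ_unique by blast
  qed
  ultimately have v0: "\<forall>i\<in>I. v i = 0" by (intro reg) auto
  have "(\<lambda>n. \<Sum>i\<in>I. (norm (u i (s n)))\<^sup>2) \<longlonglongrightarrow> (\<Sum>i\<in>I. (norm (v i))\<^sup>2)"
    using v by (intro tendsto_intros) (auto simp: o_def)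
  moreover have "(\<Sum>i\<in>I. (norm (u i n))\<^sup>2) = 1" for n
  proof -
    have "(\<Sum>i\<in>I. (norm (u i n))\<^sup>2) = (\<Sum>i\<in>I. (norm (y n - ?P i (y n)))\<^sup>2) / (?f (y n))\<^sup>2"
      using fpos[of n] unfolding sum_divide_distrib
      by (intro sum.cong) (simp_all add: u_def power_divide flip: divide_inverse_commute)
    also have "(\<Sum>i\<in>I. (norm (y n - ?P i (y n)))\<^sup>2) = (?f (y n))\<^sup>2"
      by (simp add: L2_set_def sum_nonneg)
    finally show ?thesis using fpos[of n] by simp
  qed
  ultimately have "(\<Sum>i\<in>I. (norm (v i))\<^sup>2) = 1" by (simp add: LIMSEQ_const_iff)
  then show False using v0 by simp
qed

text \<open>
  Ekeland's argument. Let \<open>f\<close> be the root of the sum of squared distances. If \<open>f x\<close> were less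
  than \<open>c\<close> times the distance of \<open>x\<close> to the intersection, then a minimizer \<open>y\<close> of
  \<open>\<lambda>y. f y + c * dist x y\<close> would still be outside the intersection and near \<open>xb\<close>. Minimality bounds
  the slope of \<open>f\<close> at \<open>y\<close> by \<open>c\<close>, whereas the lower bound on the sum of residuals makes it larger.
\<close>
lemma local_error_bound:
  fixes K :: "'i \<Rightarrow> (real ^ 'n) set"
  assumes fin: "finite I"
    and K: "\<And>i. i \<in> I \<Longrightarrow> closed (K i)" "\<And>i. i \<in> I \<Longrightarrow> convex (K i)" "\<And>i. i \<in> I \<Longrightarrow> xb \<in> K i"
    and reg: "\<And>v. \<lbrakk>\<forall>i\<in>I. v i \<in> normal_cone (K i) xb; (\<Sum>i\<in>I. v i) = 0\<rbrakk> \<Longrightarrow> \<forall>i\<in>I. v i = 0"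
  shows "\<exists>c>0. \<forall>x. dist x xb < c \<longrightarrow>
     c * infdist x (\<Inter>i\<in>I. K i) \<le> L2_set (\<lambda>i. norm (x - closest_point (K i) x)) I"
proof -
  let ?P = "\<lambda>i. closest_point (K i)"
  let ?f = "\<lambda>y. L2_set (\<lambda>i. norm (y - ?P i y)) I"
  let ?KK = "\<Inter>i\<in>I. K i"
  have xb: "xb \<in> ?KK" using K by auto
  obtain c0 where c0: "c0 > 0" "\<And>y. dist y xb < c0 \<Longrightarrow> c0 * ?f y \<le> norm (\<Sum>i\<in>I. y - ?P i y)"
    using residual_sum_lower_bound[where I=I and K=K and xb=xb, OF fin K reg] by blast
  (* Halving leaves room for y, which can be twice as far from xb as x is, and makes the slope
     comparison below strict. *)
  define c where "c = c0 / 2"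
  have c: "c > 0" using c0 by (simp add: c_def)
  have "c * infdist x ?KK \<le> ?f x" if x: "dist x xb < c" for x
  proof (rule ccontr)
    assume "\<not> ?thesis"
    then have less: "?f x < c * infdist x ?KK" by simp
    let ?R = "dist x xb"
    let ?h = "\<lambda>y. ?f y + c * dist x y"
    have "continuous_on (cball x ?R) ?h"
      unfolding L2_set_def
      using K by (intro continuous_intros continuous_on_closest_point) auto
    then obtain y where y: "y \<in> cball x ?R" and min: "\<And>z. z \<in> cball x ?R \<Longrightarrow> ?h y \<le> ?h z"
      using continuous_attains_inf[of "cball x ?R" ?h] by auto
    have hy: "?h y \<le> ?f x" using min[of x] by simp
    then have "c * dist x y < c * infdist x ?KK" using less L2_set_nonneg[of "\<lambda>i. norm (y - ?P i y)" I] by linarith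
    then have dy: "dist x y < infdist x ?KK" using c by simp
    have ynot: "y \<notin> ?KK" using dy infdist_le[of y ?KK x] by auto
    have inter: "dist x y < ?R" using dy infdist_le[OF xb, of x] by linarith
    have fy: "?f y > 0"
    proof -
      obtain i where i: "i \<in> I" "y \<notin> K i" using ynot by auto
      then have "?P i y \<noteq> y" using closest_point_in_set[of "K i" y] K[OF i(1)] by force
      then have "0 < norm (y - ?P i y)" by simp
      also have "\<dots> \<le> ?f y" using fin i by (intro member_le_L2_set)
      finally show ?thesis .
    qed
    define A where "A = (\<Sum>i\<in>I. y - ?P i y)"
    have "dist y xb < c0"
      using dist_triangle[of y xb x] inter x by (simp add: c_def dist_commute)
    then have "c0 * ?f y \<le> norm A" using c0 unfolding A_def by blast
    moreover have "c * ?f y < c0 * ?f y" using fy c0 by (simp add: c_def)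
    ultimately have slope: "c * ?f y < norm A" by linarith
    then have A0: "norm A > 0" using fy c by (meson mult_pos_pos less_trans)
    (* The step from y by - t * A, A being the gradient direction. Comparing with the old projections
       ?P i y instead of the new ones bounds (?f ?z)^2 by a quadratic in t, so that no
       differentiability of the distance functions enters. *)
    have key: "2 * (norm A)\<^sup>2 - 2 * c * norm A * ?f y \<le> t * card I * (norm A)\<^sup>2"
      if t: "0 < t" "t * norm A \<le> ?R - dist x y" "c * (t * norm A) \<le> ?f y" for t
    proof -
      let ?z = "y - t *\<^sub>R A"
      have dz: "dist x ?z \<le> dist x y + t * norm A"
        using norm_triangle_ineq[of "x - y" "t *\<^sub>R A"] t by (simp add: dist_norm algebra_simps)
      then have "?z \<in> cball x ?R" using t by simp
      then have "?h y \<le> ?h ?z" by (rule min)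
      moreover have "c * dist x ?z \<le> c * dist x y + c * (t * norm A)"
        using mult_left_mono[OF dz, of c] c by (simp add: distrib_left)
      ultimately have "?f y - c * (t * norm A) \<le> ?f ?z" by linarith
      then have "(?f y - c * (t * norm A))\<^sup>2 \<le> (?f ?z)\<^sup>2" using t by (intro power_mono) auto
      also have "\<dots> = (\<Sum>i\<in>I. (norm (?z - ?P i ?z))\<^sup>2)" by (simp add: L2_set_def sum_nonneg)
      also have "\<dots> \<le> (\<Sum>i\<in>I. (norm (?z - ?P i y))\<^sup>2)"
      proof (intro sum_mono power_mono)
        fix i assume i: "i \<in> I"
        have "?P i y \<in> K i" using K[OF i] by (intro closest_point_in_set) auto
        then show "norm (?z - ?P i ?z) \<le> norm (?z - ?P i y)"
          using closest_point_le[of "K i" "?P i y" ?z] K(1)[OF i] by (simp add: dist_norm)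
      qed auto
      also have "\<dots> = (\<Sum>i\<in>I. (norm (y - ?P i y))\<^sup>2 - 2 * t * inner A (y - ?P i y) + t\<^sup>2 * (norm A)\<^sup>2)"
      proof (rule sum.cong[OF refl])
        fix i
        have "?z - ?P i y = (y - ?P i y) - t *\<^sub>R A" by simp
        then show "(norm (?z - ?P i y))\<^sup>2 = (norm (y - ?P i y))\<^sup>2 - 2 * t * inner A (y - ?P i y) + t\<^sup>2 * (norm A)\<^sup>2"
          by (simp only: power2_norm_eq_inner inner_diff_left inner_diff_right)
             (simp add: power2_norm_eq_inner inner_commute algebra_simps power2_eq_square)
      qed
      also have "\<dots> = (?f y)\<^sup>2 - 2 * t * (norm A)\<^sup>2 + card I * (t\<^sup>2 * (norm A)\<^sup>2)"
      proof -
        have "(\<Sum>i\<in>I. 2 * t * inner A (y - ?P i y)) = 2 * t * inner A A"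
          unfolding A_def by (simp add: inner_sum_right sum_distrib_left)
        moreover have "(?f y)\<^sup>2 = (\<Sum>i\<in>I. (norm (y - ?P i y))\<^sup>2)"
          by (simp add: L2_set_def sum_nonneg)
        ultimately show ?thesis
          by (simp add: sum.distrib sum_subtractf power2_norm_eq_inner)
      qed
      finally have "(?f y - c * (t * norm A))\<^sup>2
          \<le> (?f y)\<^sup>2 - 2 * t * (norm A)\<^sup>2 + card I * (t\<^sup>2 * (norm A)\<^sup>2)" .
      moreover have "(?f y - c * (t * norm A))\<^sup>2 \<ge> (?f y)\<^sup>2 - 2 * t * (c * norm A * ?f y)"
        by (simp add: power2_diff)
      ultimately have "t * (2 * (norm A)\<^sup>2 - 2 * c * norm A * ?f y) \<le> t * (t * card I * (norm A)\<^sup>2)"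
        by (simp add: algebra_simps power2_eq_square)
      then show ?thesis using t(1) by simp
    qed
    (* A small t satisfies the side conditions of key but violates its conclusion. *)
    have "((\<lambda>t::real. t * norm A) \<longlongrightarrow> 0 * norm A) (at_right 0)"
      by (intro tendsto_intros)
    then have e1: "\<forall>\<^sub>F t::real in at_right 0. t * norm A < ?R - dist x y"
      using inter by (intro order_tendstoD) auto
    have "((\<lambda>t::real. c * (t * norm A)) \<longlongrightarrow> c * (0 * norm A)) (at_right 0)"
      by (intro tendsto_intros)
    then have e2: "\<forall>\<^sub>F t::real in at_right 0. c * (t * norm A) < ?f y"
      using fy by (intro order_tendstoD) auto
    have gap: "0 < 2 * (norm A)\<^sup>2 - 2 * c * norm A * ?f y"
      using mult_strict_left_mono[OF slope A0] by (simp add: power2_eq_square algebra_simps)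
    have "((\<lambda>t::real. t * card I * (norm A)\<^sup>2) \<longlongrightarrow> 0 * real (card I) * (norm A)\<^sup>2) (at_right 0)"
      by (intro tendsto_intros)
    then have e3: "\<forall>\<^sub>F t::real in at_right 0. t * card I * (norm A)\<^sup>2 < 2 * (norm A)\<^sup>2 - 2 * c * norm A * ?f y"
      using gap by (intro order_tendstoD) auto
    have e0: "\<forall>\<^sub>F t::real in at_right 0. 0 < t" by (rule eventually_at_right_less)
    from eventually_conj[OF eventually_conj[OF e0 e1] eventually_conj[OF e2 e3]]
    have "\<exists>t::real. (0 < t \<and> t * norm A < ?R - dist x y) \<and>
        (c * (t * norm A) < ?f y \<and> t * card I * (norm A)\<^sup>2 < 2 * (norm A)\<^sup>2 - 2 * c * norm A * ?f y)"
      by (rule eventually_happens'[OF trivial_limit_at_right_real])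
    then obtain t where "0 < t" "t * norm A < ?R - dist x y" "c * (t * norm A) < ?f y"
      "t * card I * (norm A)\<^sup>2 < 2 * (norm A)\<^sup>2 - 2 * c * norm A * ?f y"
      by blast
    with key[of t] show False by linarith
  qed
  then show ?thesis using c by blast
qed

section \<open>The iterates of the mass projection algorithm\<close>

lemma mp_F_eq_Inter:
  "mp_F r K p x i =
     (\<Inter>j\<in>{1..r}. \<Inter>l\<in>{max 1 (i - p)..i}. {y. inner (mp_a K x l j) y \<le> mp_b K x l j})"
  by (auto simp: mp_F_def)

lemma closed_convex_mp_F: "closed (mp_F r K p x i)" "convex (mp_F r K p x i)"
  unfolding mp_F_eq_Inter
  by (intro closed_INT convex_INT ballI closed_halfspace_le convex_halfspace_le)+

lemma mp_F_superset:
  assumes "\<And>j. j \<in> {1..r} \<Longrightarrow> closed (K j)" "\<And>j. j \<in> {1..r} \<Longrightarrow> convex (K j)"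
    and "z \<in> (\<Inter>j\<in>{1..r}. K j)"
  shows "z \<in> mp_F r K p x i"
proof -
  have "inner (mp_a K x l j) z \<le> mp_b K x l j" if "j \<in> {1..r}" for l j
    using closest_point_dot[of "K j" z "x (l - 1)"] assms that
    by (auto simp: mp_a_def mp_b_def mp_point_def inner_diff_right)
  then show ?thesis by (auto simp: mp_F_def)
qed

lemma mass_projection_fejer:
  assumes "\<And>j. j \<in> {1..r} \<Longrightarrow> closed (K j)" "\<And>j. j \<in> {1..r} \<Longrightarrow> convex (K j)"
    and "z \<in> (\<Inter>j\<in>{1..r}. K j)" and "mass_projection_iterates r K p x" and "k \<le> m"
  shows "dist (x m) z \<le> dist (x k) z"
  using \<open>k \<le> m\<close>
proof (induction rule: dec_induct)
  case (step n)
  have "x (Suc n) = closest_point (mp_F r K p x (Suc n)) (x n)"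
    using assms(4) unfolding mass_projection_iterates_def by force
  then have "dist (x (Suc n)) z \<le> dist (x n) z"
    using dist_closest_point_le[OF closed_convex_mp_F(2,1)] mp_F_superset[OF assms(1-3)] by metis
  then show ?case using step by linarith
qed simp

text \<open>
  The cut made at \<open>x k\<close> carries the index \<open>k + 1\<close> in the algorithm. Step \<open>m\<close> uses the cuts with
  indices from \<open>m - p\<close> to \<open>m\<close>, which explains the bound \<open>k + p + 1\<close>.
\<close>
lemma mass_projection_cut:
  assumes K: "\<And>j. j \<in> {1..r} \<Longrightarrow> closed (K j)" "\<And>j. j \<in> {1..r} \<Longrightarrow> convex (K j)"
    and z: "z \<in> (\<Inter>j\<in>{1..r}. K j)" and it: "mass_projection_iterates r K p x"
    and j: "j \<in> {1..r}" and km: "k < m" "m \<le> k + p + 1"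
  shows "inner (x k - closest_point (K j) (x k)) (x m - closest_point (K j) (x k)) \<le> 0"
proof -
  have "mp_F r K p x m \<noteq> {}" using mp_F_superset[OF K z] by blast
  then have "closest_point (mp_F r K p x m) (x (m - 1)) \<in> mp_F r K p x m"
    by (rule closest_point_in_set[OF closed_convex_mp_F(1)])
  moreover have "x m = closest_point (mp_F r K p x m) (x (m - 1))"
    using it km unfolding mass_projection_iterates_def by auto
  ultimately have "x m \<in> mp_F r K p x m" by simp
  moreover have "Suc k \<in> {max 1 (m - p)..m}" using km by auto
  ultimately have "inner (mp_a K x (Suc k) j) (x m) \<le> mp_b K x (Suc k) j"
    using j unfolding mp_F_def by blast
  then show ?thesis by (simp add: mp_a_def mp_b_def mp_point_def inner_diff_right)
qed

text \<open>
  Let \<open>z\<close> be the point of the intersection nearest to \<open>x k\<close>. The distances of the iterates to \<open>z\<close>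
  decrease, so the limit \<open>xb\<close> is at most as far from \<open>z\<close> as \<open>x k\<close> is.
\<close>
lemma dist_limit_le_infdist:
  assumes K: "\<And>j. j \<in> {1..r} \<Longrightarrow> closed (K j)" "\<And>j. j \<in> {1..r} \<Longrightarrow> convex (K j)"
    and xb: "xb \<in> (\<Inter>j\<in>{1..r}. K j)" and it: "mass_projection_iterates r K p x"
    and lim: "x \<longlonglongrightarrow> xb"
  shows "dist (x k) xb \<le> 2 * infdist (x k) (\<Inter>j\<in>{1..r}. K j)"
proof -
  let ?KK = "\<Inter>j\<in>{1..r}. K j"
  have "closed ?KK" using K by (intro closed_INT) auto
  then obtain z where z: "z \<in> ?KK" "infdist (x k) ?KK = dist (x k) z"
    using infdist_attains_inf xb by blast
  have "(\<lambda>m. dist (x m) z) \<longlonglongrightarrow> dist xb z" using lim by (intro tendsto_intros)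
  then have "dist xb z \<le> dist (x k) z"
    using mass_projection_fejer[OF K z(1) it] by (intro LIMSEQ_le_const2) auto
  then show ?thesis using dist_triangle2[of "x k" xb z] z by simp
qed

section \<open>Packing of directions and the contraction estimate\<close>

lemma unit_ball_packing:
  assumes "0 < e"
  shows "\<exists>N. \<forall>p\<ge>N. \<forall>w :: nat \<Rightarrow> 'a::euclidean_space. (\<forall>k\<le>p. norm (w k) \<le> 1) \<longrightarrow>
           (\<exists>k m. k < m \<and> m \<le> p \<and> dist (w k) (w m) < e)"
proof -
  have "cball (0::'a) 1 \<subseteq> (\<Union>t\<in>cball 0 1. ball t (e/2))"
    using assms by (intro subsetI UN_I) auto
  then obtain T where T: "finite T" "cball (0::'a) 1 \<subseteq> (\<Union>t\<in>T. ball t (e/2))"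
    using compactE_image[OF compact_cball, of "cball 0 1" "\<lambda>t. ball t (e/2)"] by (metis open_ball)
  have "\<exists>k m. k < m \<and> m \<le> p \<and> dist (w k) (w m) < e"
    if p: "p \<ge> card T" and w: "\<forall>k\<le>p. norm (w k) \<le> 1" for p and w :: "nat \<Rightarrow> 'a"
  proof -
    have "\<forall>k\<in>{..p}. \<exists>t\<in>T. dist t (w k) < e/2" using w T by (force simp: subset_iff)
    then obtain g where g: "\<And>k. k \<le> p \<Longrightarrow> g k \<in> T \<and> dist (g k) (w k) < e/2" by (metis atMost_iff)
    have "card (g ` {..p}) \<le> card T" using g T by (intro card_mono) auto
    then have "\<not> inj_on g {..p}" using p by (intro pigeonhole) simp
    then obtain k m where "k < m" "m \<le> p" "g k = g m"
      unfolding inj_on_def by (metis atMost_iff linorder_neqE_nat)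
    moreover then have "dist (w k) (w m) < e"
      using g[of k] g[of m] dist_triangle_half_r[of "g k" "w k" e "w m"] by simp
    ultimately show ?thesis by blast
  qed
  then show ?thesis by blast
qed

text \<open>
  The separation argument. The factor \<open>\<eta>\<close> is kept as a parameter that does not influence the packing
  condition; positive values serve superlinear convergence, and \<open>\<eta> = 0\<close> serves finite convergence.
\<close>
lemma mass_projection_contraction:
  fixes K :: "nat \<Rightarrow> (real ^ 'n) set"
  assumes K: "\<And>j. j \<in> {1..r} \<Longrightarrow> closed (K j)" "\<And>j. j \<in> {1..r} \<Longrightarrow> convex (K j)"
    and xb: "xb \<in> (\<Inter>j\<in>{1..r}. K j)"
    and it: "mass_projection_iterates r K p x"
    and c: "0 < c"
    and deep: "\<And>k. i \<le> k \<Longrightarrow> \<exists>j\<in>{1..r}. c * norm (x k - xb) \<le> norm (x k - closest_point (K j) (x k))"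
    and \<eta>: "0 \<le> \<eta>"
    and offset: "\<And>k j. \<lbrakk>i \<le> k; j \<in> {1..r}\<rbrakk> \<Longrightarrow>
        inner (x k - closest_point (K j) (x k)) (closest_point (K j) (x k) - xb)
          \<le> \<eta> * norm (x k - closest_point (K j) (x k)) * norm (x k - xb)"
    and pack: "\<And>w :: nat \<Rightarrow> real ^ 'n. \<forall>k\<le>p. norm (w k) \<le> 1 \<Longrightarrow>
        \<exists>k m. k < m \<and> m \<le> p \<and> dist (w k) (w m) < c / 2"
  shows "c / 2 * norm (x (i + p) - xb) \<le> \<eta> * norm (x i - xb)"
proof (rule ccontr)
  assume "\<not> ?thesis"
  then have stag: "\<eta> * norm (x i - xb) < c / 2 * norm (x (i + p) - xb)" by simp
  have mono: "norm (x m - xb) \<le> norm (x k - xb)" if "k \<le> m" for k m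
    using mass_projection_fejer[OF K xb it that] by (simp add: dist_norm)
  have "0 \<le> \<eta> * norm (x i - xb)" using \<eta> by simp
  then have "0 < c / 2 * norm (x (i + p) - xb)" using stag by linarith
  then have endpos: "0 < norm (x (i + p) - xb)" using c by (simp add: zero_less_mult_iff)
  (* Two iterates of the window with nearby directions; the deep cut made at the earlier one will
     separate these directions. *)
  obtain k m where km: "k < m" "m \<le> p" and near: "dist (sgn (x (i + k) - xb)) (sgn (x (i + m) - xb)) < c / 2"
    using pack[of "\<lambda>k. sgn (x (i + k) - xb)"] by (metis norm_sgn order_refl zero_le_one)
  define e where "e = x (i + k) - xb"
  define e' where "e' = x (i + m) - xb"
  have e'end: "norm (x (i + p) - xb) \<le> norm e'" and ee': "norm e' \<le> norm e" and ei: "norm e \<le> norm (x i - xb)"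
    using km by (auto simp: e_def e'_def intro!: mono)
  have pos: "0 < norm e'" "0 < norm e" using endpos e'end ee' by linarith+
  obtain j where j: "j \<in> {1..r}" and dj: "c * norm e \<le> norm (x (i + k) - closest_point (K j) (x (i + k)))"
    using deep[of "i + k"] by (auto simp: e_def)
  define q where "q = closest_point (K j) (x (i + k))"
  define a where "a = x (i + k) - q"
  have a: "c * norm e \<le> norm a" using dj by (simp add: a_def q_def)
  then have apos: "0 < norm a" using c pos mult_pos_pos less_le_trans by blast
  have "inner a (xb - q) \<le> 0"
    using closest_point_dot[of "K j" xb "x (i + k)"] K[OF j] xb j by (auto simp: a_def q_def)
  moreover have "e = a - (xb - q)" by (simp add: e_def a_def)
  ultimately have "norm a * norm a \<le> inner a e"
    by (simp add: inner_diff_right norm_eq_sqrt_inner)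
  moreover have "norm a * (c * norm e) \<le> norm a * norm a" using a by (intro mult_left_mono) auto
  ultimately have "norm a * (c * norm e) \<le> inner a e" by linarith
  then have lower: "norm a * c \<le> inner a (sgn e)"
    using pos by (simp add: inner_sgn_right le_divide_eq divide_le_eq mult.assoc)
  have "inner a (x (i + m) - q) \<le> 0"
    using mass_projection_cut[OF K xb it j, of "i + k" "i + m"] km by (simp add: a_def q_def)
  moreover have "e' = (x (i + m) - q) + (q - xb)" by (simp add: e'_def)
  ultimately have "inner a e' \<le> inner a (q - xb)" by (simp only: inner_add_right)
  also have "\<dots> \<le> \<eta> * norm a * norm e" using offset[OF _ j, of "i + k"] by (simp add: a_def q_def e_def)
  also have "\<dots> = norm a * (\<eta> * norm e)" by simp
  also have "\<dots> \<le> norm a * (\<eta> * norm (x i - xb))" using ei \<eta> by (intro mult_left_mono) auto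
  also have "\<dots> \<le> norm a * (c / 2 * norm (x (i + p) - xb))" using stag by (intro mult_left_mono) auto
  also have "\<dots> \<le> norm a * (c / 2 * norm e')" using e'end c by (intro mult_left_mono) auto
  finally have "inner a (sgn e') \<le> norm a * (c / 2)"
    using pos by (simp add: inner_sgn_right le_divide_eq divide_le_eq mult.assoc)
  then have "norm a * (c / 2) \<le> inner a (sgn e - sgn e')" using lower by (simp add: inner_diff_right)
  also have "\<dots> \<le> norm a * norm (sgn e - sgn e')" by (rule norm_cauchy_schwarz)
  also have "\<dots> < norm a * (c / 2)"
    using near apos by (simp add: dist_norm e_def e'_def)
  finally show False by simp
qed

section \<open>Superlinear and finite convergence\<close>

theorem theorem5p11:
  fixes r :: nat
    and K :: "nat \<Rightarrow> (real ^ 'n) set"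
    and xbar :: "real ^ 'n"
  assumes "1 \<le> r"
    and "\<And>l. l \<in> {1..r} \<Longrightarrow> closed (K l)"
    and "\<And>l. l \<in> {1..r} \<Longrightarrow> convex (K l)"
    and "xbar \<in> (\<Inter>l\<in>{1..r}. K l)"
    and "\<And>v. (\<forall>l\<in>{1..r}. v l \<in> normal_cone (K l) xbar) \<Longrightarrow> (\<Sum>l=1..r. v l) = 0
           \<Longrightarrow> (\<forall>l\<in>{1..r}. v l = 0)"
  shows "\<exists>P::nat. \<forall>p\<ge>P. 0 < p \<longrightarrow>
    (\<forall>x. mass_projection_iterates r K p x \<longrightarrow> x \<longlonglongrightarrow> xbar \<longrightarrow>
       limsup (\<lambda>i. ereal (norm (x (i + p) - xbar) / norm (x i - xbar))) = 0 \<and>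
       ((\<exists>\<epsilon>>0. \<forall>l\<in>{1..r}.
           (\<lambda>y. y - xbar) ` K l \<inter> cball 0 \<epsilon> = tangent_cone (K l) xbar \<inter> cball 0 \<epsilon>)
         \<longrightarrow> (\<exists>N. \<forall>i\<ge>N. x i = xbar)))"
proof -
  let ?KK = "\<Inter>l\<in>{1..r}. K l"
  note K = assms(2,3) and xb = assms(4)
  have xbK: "xbar \<in> K j" if "j \<in> {1..r}" for j using xb that by auto
  obtain c0 where c0: "c0 > 0" "\<And>x. dist x xbar < c0 \<Longrightarrow>
      c0 * infdist x ?KK \<le> L2_set (\<lambda>j. norm (x - closest_point (K j) x)) {1..r}"
    using local_error_bound[where I="{1..r}" and K=K and xb=xbar, OF _ K xbK assms(5)] by blast
  (* The factor 2 is the loss from the limit to the nearest point of the intersection; the factor r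
     is the loss from the sum of the r distances to the largest one. *)
  define c where "c = c0 / (2 * r)"
  have c: "c > 0" using c0 assms(1) by (simp add: c_def)
  obtain P where P: "\<And>p (w :: nat \<Rightarrow> real ^ 'n). \<lbrakk>P \<le> p; \<forall>k\<le>p. norm (w k) \<le> 1\<rbrakk> \<Longrightarrow>
      \<exists>k m. k < m \<and> m \<le> p \<and> dist (w k) (w m) < c / 2"
    using unit_ball_packing[of "c / 2"] c by (metis half_gt_zero)
  show ?thesis
  proof (rule exI[of _ P], intro allI impI conjI)
    fix p x
    assume p: "P \<le> p" and it: "mass_projection_iterates r K p x" and lim: "x \<longlonglongrightarrow> xbar"
    have deep: "\<exists>j\<in>{1..r}. c * norm (x k - xbar) \<le> norm (x k - closest_point (K j) (x k))"
      if k: "dist (x k) xbar < c0" for k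
    proof (rule ccontr)
      let ?d = "\<lambda>j. norm (x k - closest_point (K j) (x k))"
      assume "\<not> ?thesis"
      then have "?d j < c * norm (x k - xbar)" if "j \<in> {1..r}" for j
        using that not_le by blast
      then have "sum ?d {1..r} < (\<Sum>j\<in>{1..r}. c * norm (x k - xbar))"
        using assms(1) by (intro sum_strict_mono) auto
      also have "\<dots> = c0 * (norm (x k - xbar) / 2)" using assms(1) by (simp add: c_def)
      also have "\<dots> \<le> c0 * infdist (x k) ?KK"
        using dist_limit_le_infdist[OF K xb it lim, of k] c0(1)
        by (intro mult_left_mono) (auto simp: dist_norm)
      also have "\<dots> \<le> L2_set ?d {1..r}" using c0(2)[OF k] .
      also have "\<dots> \<le> sum ?d {1..r}" by (rule L2_set_le_sum) simp
      finally show False by simp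
    qed
    obtain i0 where i0: "\<And>k. i0 \<le> k \<Longrightarrow> dist (x k) xbar < c0"
      using lim c0(1) unfolding lim_sequentially by blast
    have proj: "closest_point (K j) y \<in> K j" "dist (closest_point (K j) y) xbar \<le> dist y xbar"
      "y - closest_point (K j) y \<in> normal_cone (K j) (closest_point (K j) y)" if "j \<in> {1..r}" for j y
      using K[OF that] xbK[OF that]
      by (auto intro: closest_point_in_set dist_closest_point_le residual_in_normal_cone)
    have contract: "c / 2 * norm (x (i + p) - xbar) \<le> \<eta> * norm (x i - xbar)"
      if "0 \<le> \<eta>" "i0 \<le> i" and
        offset: "\<And>k j. \<lbrakk>i \<le> k; j \<in> {1..r}\<rbrakk> \<Longrightarrow>
          inner (x k - closest_point (K j) (x k)) (closest_point (K j) (x k) - xbar)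
            \<le> \<eta> * norm (x k - closest_point (K j) (x k)) * norm (x k - xbar)" for i \<eta>
      using that p by (intro mass_projection_contraction[OF K xb it c] deep i0 P) auto
    show "limsup (\<lambda>i. ereal (norm (x (i + p) - xbar) / norm (x i - xbar))) = 0"
    proof -
      have "(\<lambda>i. norm (x (i + p) - xbar) / norm (x i - xbar)) \<longlonglongrightarrow> 0"
      proof (rule LIMSEQ_I)
        fix \<delta> :: real assume \<delta>: "0 < \<delta>"
        (* Chosen so that the contraction factor 2 * \<eta> / c is \<delta> / 2, strictly below \<delta>. *)
        define \<eta> where "\<eta> = c * \<delta> / 4"
        have \<eta>: "\<eta> > 0" using c \<delta> by (simp add: \<eta>_def)
        have "\<forall>j. \<exists>\<rho>>0. \<forall>y\<in>K j. dist y xbar < \<rho> \<longrightarrow>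
           (\<forall>v\<in>normal_cone (K j) y. inner v (y - xbar) \<le> \<eta> * norm v * norm (y - xbar))"
          using normal_offset_small[OF \<eta>] by blast
        then obtain \<rho> where \<rho>: "\<And>j. \<rho> j > 0" "\<And>j y v. \<lbrakk>y \<in> K j; dist y xbar < \<rho> j; v \<in> normal_cone (K j) y\<rbrakk> \<Longrightarrow>
             inner v (y - xbar) \<le> \<eta> * norm v * norm (y - xbar)"
          by metis
        have "\<forall>\<^sub>F k in sequentially. \<forall>j\<in>{1..r}. dist (x k) xbar < \<rho> j"
          using \<rho>(1) by (intro eventually_ball_finite ballI tendstoD[OF lim]) auto
        then obtain i1 where i1: "\<And>k j. \<lbrakk>i1 \<le> k; j \<in> {1..r}\<rbrakk> \<Longrightarrow> dist (x k) xbar < \<rho> j"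
          unfolding eventually_sequentially by blast
        have "norm (norm (x (i + p) - xbar) / norm (x i - xbar) - 0) < \<delta>" if i: "max i0 i1 \<le> i" for i
        proof -
          have "inner (x k - closest_point (K j) (x k)) (closest_point (K j) (x k) - xbar)
            \<le> \<eta> * norm (x k - closest_point (K j) (x k)) * norm (x k - xbar)"
            if kj: "i \<le> k" "j \<in> {1..r}" for k j
          proof -
            let ?q = "closest_point (K j) (x k)"
            have d: "dist (x k) xbar < \<rho> j" using i1 i kj by auto
            have "inner (x k - ?q) (?q - xbar) \<le> \<eta> * norm (x k - ?q) * norm (?q - xbar)"
              using d proj[OF kj(2)] by (intro \<rho>(2)) (auto intro: le_less_trans)
            also have "\<dots> \<le> \<eta> * norm (x k - ?q) * norm (x k - xbar)"
              using proj(2)[OF kj(2), of "x k"] \<eta> by (intro mult_left_mono) (auto simp: dist_norm)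
            finally show ?thesis .
          qed
          then have "c / 2 * norm (x (i + p) - xbar) \<le> \<eta> * norm (x i - xbar)"
            using i \<eta> by (intro contract) auto
          also have "\<dots> = c / 2 * (\<delta> / 2 * norm (x i - xbar))" by (simp add: \<eta>_def)
          finally have "norm (x (i + p) - xbar) \<le> \<delta> / 2 * norm (x i - xbar)"
            using c by simp
          then have "norm (x (i + p) - xbar) / norm (x i - xbar) \<le> \<delta> / 2"
            using \<delta> by (cases "x i = xbar") (simp_all add: divide_le_eq)
          moreover have "0 \<le> norm (x (i + p) - xbar) / norm (x i - xbar)" by simp
          ultimately show ?thesis using \<delta> by (simp only: real_norm_def diff_0_right abs_of_nonneg)
        qed
        then show "\<exists>n0. \<forall>i\<ge>n0. norm (norm (x (i + p) - xbar) / norm (x i - xbar) - 0) < \<delta>" by blast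
      qed
      then have "(\<lambda>i. ereal (norm (x (i + p) - xbar) / norm (x i - xbar))) \<longlonglongrightarrow> 0"
        by (simp add: zero_ereal_def)
      then show ?thesis by (intro lim_imp_Limsup) auto
    qed
    assume "\<exists>\<epsilon>>0. \<forall>l\<in>{1..r}.
           (\<lambda>y. y - xbar) ` K l \<inter> cball 0 \<epsilon> = tangent_cone (K l) xbar \<inter> cball 0 \<epsilon>"
    then obtain \<epsilon> where \<epsilon>: "\<epsilon> > 0" "\<And>l. l \<in> {1..r} \<Longrightarrow>
           (\<lambda>y. y - xbar) ` K l \<inter> cball 0 \<epsilon> = tangent_cone (K l) xbar \<inter> cball 0 \<epsilon>"
      by blast
    obtain i1 where i1: "\<And>k. i1 \<le> k \<Longrightarrow> dist (x k) xbar < \<epsilon> / 2"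
      using lim \<epsilon>(1) unfolding lim_sequentially by (meson half_gt_zero)
    have "x (i + p) = xbar" if i: "max i0 i1 \<le> i" for i
    proof -
      have "inner (x k - closest_point (K j) (x k)) (closest_point (K j) (x k) - xbar) \<le> 0"
        if kj: "i \<le> k" "j \<in> {1..r}" for k j
        using proj[OF kj(2), of "x k"] i1[of k] i kj
        by (intro normal_offset_nonpos_if_conical[OF \<epsilon>(2)[OF kj(2)]]) (auto simp: dist_norm)
      then have "c / 2 * norm (x (i + p) - xbar) \<le> 0 * norm (x i - xbar)"
        using i by (intro contract) auto
      then show ?thesis using c by (simp add: mult_le_0_iff)
    qed
    then have "x n = xbar" if "max i0 i1 + p \<le> n" for n
      using that by (metis add_leD2 le_add_diff_inverse2 le_diff_conv2)
    then show "\<exists>N. \<forall>i\<ge>N. x i = xbar" by blast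
  qed
qed

end
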